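(* $$\tilde{\mathfrak{S}}(123,312)^{\mathsf{des},\mathsf{iar},\mathsf{comp}}(t,r,p)=\frac{1+rpz}{1-tz}+\frac{(r+p)tz^2}{(1-tz)^2}+\frac{t^2z^3}{(1-tz)^3}.$$
   Context: $\mathfrak{S}_n$ is the set of permutations $\pi=\pi(1)\cdots\pi(n)$ of $[n]=\{1,\dots,n\}$. A permutation $\pi\in\mathfrak{S}_n$ contains the pattern $\sigma\in\mathfrak{S}_k$ if there are $j_1<\cdots<j_k$ such that $\pi(j_a)<\pi(j_b)$ if and only if $\sigma(a)<\sigma(b)$ for all $1\le a<b\le k$; otherwise it avoids $\sigma$. For a set $P$ of patterns, $\mathfrak{S}_n(P)$ is the set of $\pi\in\mathfrak{S}_n$ avoiding every pattern in $P$. For $\pi\in\mathfrak{S}_n$: $\mathrm{DES}(\pi)=\{i\in[n-1]:\pi(i)>\pi(i+1)\}$, $\mathsf{des}(\pi)=|\mathrm{DES}(\pi)|$, $\mathsf{iar}(\pi)=\min(\mathrm{DES}(\pi)\cup\{n\})$, $\mathsf{comp}(\pi)=|\{i\in[n]:\pi(j)\le i\text{ for all }j\le i\}|$. Define the formal power series in $z$ $$\mathfrak{S}(P)^{\mathsf{des},\mathsf{iar},\mathsf{comp}}(t,r,p;z)=\sum_{n\ge0}z^n\sum_{\pi\in\mathfrak{S}_n(P)}t^{\mathsf{des}(\pi)}r^{\mathsf{iar}(\pi)}p^{\mathsf{comp}(\pi)},$$ where the empty permutation ($n=0$) contributes $1$, and $\tilde{\mathfrak{S}}(P)^{\mathsf{des},\mathsf{iar},\mathsf{comp}}(t,r,p)=\big(\mathfrak{S}(P)^{\mathsf{des},\mathsf{iar},\mathsf{comp}}(t,r,p;z)-1\big)/(rpz)$.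 *)

theory Defs
  imports "HOL-Combinatorics.Multiset_Permutations"
    "HOL-Computational_Algebra.Formal_Power_Series"
begin

text \<open>
  A permutation of \<open>[n]\<close> is its one-line notation \<open>\<pi>(1) \<dots> \<pi>(n)\<close>, i.e. an element of
  \<^term>\<open>permutations_of_set {1..n}\<close>; \<open>ent \<pi> i\<close> is \<open>\<pi>(i)\<close>, with positions counted from 1.
  Patterns are permutations in the same notation.
\<close>

definition ent :: "nat list \<Rightarrow> nat \<Rightarrow> nat" where
  "ent \<pi> i = \<pi> ! (i - 1)"

definition contains_pattern :: "nat list \<Rightarrow> nat list \<Rightarrow> bool" where
  "contains_pattern \<pi> \<sigma> \<longleftrightarrow>
     (\<exists>j :: nat \<Rightarrow> nat. j ` {1..length \<sigma>} \<subseteq> {1..length \<pi>} \<and> strict_mono_on {1..length \<sigma>} j \<and>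
        (\<forall>a b. 1 \<le> a \<and> a < b \<and> b \<le> length \<sigma> \<longrightarrow>
           (ent \<pi> (j a) < ent \<pi> (j b) \<longleftrightarrow> ent \<sigma> a < ent \<sigma> b)))"

definition avoiders :: "nat \<Rightarrow> nat list set \<Rightarrow> nat list set" where
  "avoiders n P = {\<pi> \<in> permutations_of_set {1..n}. \<forall>\<sigma>\<in>P. \<not> contains_pattern \<pi> \<sigma>}"

definition DES :: "nat list \<Rightarrow> nat set" where
  "DES \<pi> = {i \<in> {1..<length \<pi>}. ent \<pi> i > ent \<pi> (i + 1)}"

definition des :: "nat list \<Rightarrow> nat" where
  "des \<pi> = card (DES \<pi>)"

definition iar :: "nat list \<Rightarrow> nat" where
  "iar \<pi> = Min (DES \<pi> \<union> {length \<pi>})"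

definition perm_comp :: "nat list \<Rightarrow> nat" where
  "perm_comp \<pi> = card {i \<in> {1..length \<pi>}. \<forall>j\<in>{1..i}. ent \<pi> j \<le> i}"

text \<open>
  The variable \<open>z\<close> is \<^term>\<open>fps_X\<close>; the weights \<open>t\<close>, \<open>r\<close>, \<open>p\<close> are elements of an arbitrary
  field, which covers indeterminates (generators of a rational function field).
\<close>

definition perm_gf :: "nat list set \<Rightarrow> 'a \<Rightarrow> 'a \<Rightarrow> 'a \<Rightarrow> 'a :: field fps" where
  "perm_gf P t r p =
     Abs_fps (\<lambda>n. \<Sum>\<pi>\<in>avoiders n P. t ^ des \<pi> * r ^ iar \<pi> * p ^ perm_comp \<pi>)"

text \<open>
  For \<open>r, p \<noteq> 0\<close> the division below is exact, as the numerator has no constant term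
  (lemma \<open>perm_gf_tilde_exact\<close>).
\<close>

definition perm_gf_tilde :: "nat list set \<Rightarrow> 'a \<Rightarrow> 'a \<Rightarrow> 'a \<Rightarrow> 'a :: field fps" where
  "perm_gf_tilde P t r p = (perm_gf P t r p - 1) / (fps_const r * fps_const p * fps_X)"

lemma perm_gf_nth_0:
  assumes "[] \<notin> P"
  shows "fps_nth (perm_gf P t r p) 0 = 1"
proof -
  have "\<not> contains_pattern [] \<sigma>" if "\<sigma> \<in> P" for \<sigma>
    using that assms by (cases \<sigma>) (auto simp: contains_pattern_def)
  then have "avoiders 0 P = {[]}"
    by (auto simp: avoiders_def)
  moreover have "perm_comp [] = 0"
    unfolding perm_comp_def by (simp only: list.size) simp
  ultimately show ?thesis
    by (simp add: perm_gf_def des_def DES_def iar_def)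
qed

lemma perm_gf_tilde_exact:
  fixes t r p :: "'a :: field"
  assumes "[] \<notin> P" and "r \<noteq> 0" and "p \<noteq> 0"
  shows "fps_const r * fps_const p * fps_X * perm_gf_tilde P t r p = perm_gf P t r p - 1"
proof -
  let ?f = "perm_gf P t r p - 1"
  let ?c = "fps_const r * fps_const p :: 'a fps"
  have "fps_nth ?f 0 = 0"
    using assms by (simp add: perm_gf_nth_0)
  then have shift: "fps_X * fps_shift 1 ?f = ?f"
    by (intro fps_ext) auto
  have unit: "?c * fps_const (inverse (r * p)) = 1"
    using assms by (simp add: field_simps)
  have "?c * fps_X * (fps_const (inverse (r * p)) * fps_shift 1 ?f)
      = (?c * fps_const (inverse (r * p))) * (fps_X * fps_shift 1 ?f)"
    by (simp only: mult_ac)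
  also have "\<dots> = ?f"
    by (simp only: unit shift mult_1_left)
  finally have "?c * fps_X dvd ?f"
    by (metis dvd_triv_left)
  then show ?thesis
    unfolding perm_gf_tilde_def by (rule dvd_mult_div_cancel)
qed

end

theory Submission
  imports Defs
begin

text \<open>
  An ascent \<open>a b\<close> at consecutive positions leaves almost no freedom to a permutation that avoids
  123 and 312. Everything after \<open>b\<close> is smaller than \<open>b\<close>, by avoidance of 123 with \<open>a b\<close> in front,
  and hence decreasing, by avoidance of 312 with \<open>b\<close> as the 3. The entries up to
  \<open>a\<close> decrease too, since the upper entry \<open>d\<close> of an increasing pair among them would form a 312 with
  \<open>a b\<close> or, if \<open>d < b\<close>, the pair a 123 with \<open>b\<close>. So the permutation consists of two decreasing
  runs, the first from some \<open>y\<close> down to some \<open>x\<close> (\<open>decreasing_if_avoids_after_ascent\<close>). A later value strictly between \<open>x\<close>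
  and \<open>y\<close> would complete a 312 with \<open>y\<close> and \<open>x\<close>, so the first run is the whole interval
  \<open>{x..y}\<close>, and there is an ascent after it only if \<open>n\<close> is in the second run, that is, \<open>y < n\<close>.
  Conversely every pair \<open>1 \<le> x \<le> y < n\<close> gives an avoider \<open>two_runs n x y\<close>. Together with the
  decreasing permutation these are all of them (\<open>avoiders_123_312\<close>).

  The statistics depend only on where \<open>(x, y)\<close> lies in the triangle. There is exactly one ascent, so
  \<open>des = n - 2\<close>; it is at position 1 exactly when \<open>x = y\<close>, so \<open>iar\<close> is 2 in that case and 1
  otherwise; and \<open>n\<close> directly follows the first run, so the only prefix other than the whole
  word that can be closed is the first run itself, when it is \<open>{1..y}\<close>; so \<open>comp\<close> is 2 if \<open>x = 1\<close>
  and 1 otherwise. Up to the common factor \<open>r p t\<^sup>n\<^sup>-\<^sup>2\<close>, the corner \<open>x = y = 1\<close> has weight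
  \<open>r p\<close>, the other \<open>n - 2\<close> points of each of the two sides have weight \<open>r\<close> and \<open>p\<close>, and the remaining
  \<open>(n-2) choose 2\<close> points have weight 1 (\<open>sum_over_pairs\<close>). These multiplicities are the coefficients
  of the first, second and third power of the geometric series in \<open>t z\<close>, which gives the three
  fractions; the decreasing permutation, of weight \<open>r p t\<^sup>n\<^sup>-\<^sup>1\<close>, accounts for the 1 in the first
  numerator.
\<close>

section \<open>Patterns of length three\<close>

text \<open>
  With three explicit positions, counted from 0, in place of the embedding \<open>j\<close>, avoidance becomes
  a plain statement about list indices.
\<close>

lemma contains_pattern3:
  "contains_pattern \<pi> [a, b, c] \<longleftrightarrow>
    (\<exists>i j k. i < j \<and> j < k \<and> k < length \<pi> \<and> (\<pi> ! i < \<pi> ! j \<longleftrightarrow> a < b)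
       \<and> (\<pi> ! i < \<pi> ! k \<longleftrightarrow> a < c) \<and> (\<pi> ! j < \<pi> ! k \<longleftrightarrow> b < c))"
  (is "?L \<longleftrightarrow> ?R")
proof
  assume ?L
  then obtain j where j: "j ` {1..3} \<subseteq> {1..length \<pi>}" "strict_mono_on {1..3} j"
    and pat: "\<And>u v. 1 \<le> u \<Longrightarrow> u < v \<Longrightarrow> v \<le> 3 \<Longrightarrow>
      ent \<pi> (j u) < ent \<pi> (j v) \<longleftrightarrow> ent [a, b, c] u < ent [a, b, c] v"
    by (auto simp: contains_pattern_def eval_nat_numeral)
  have "j 1 < j 2" "j 2 < j 3"
    using j(2) by (auto simp: strict_mono_on_def)
  moreover have "1 \<le> j 1" "j 3 \<le> length \<pi>"
    using j(1) by (auto simp: image_subset_iff)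
  ultimately show ?R
    using pat[of 1 2] pat[of 1 3] pat[of 2 3]
    by (intro exI[of _ "j 1 - 1"] exI[of _ "j 2 - 1"] exI[of _ "j 3 - 1"])
      (auto simp: ent_def)
next
  assume ?R
  then obtain i j k where *: "i < j" "j < k" "k < length \<pi>" "\<pi> ! i < \<pi> ! j \<longleftrightarrow> a < b"
       "\<pi> ! i < \<pi> ! k \<longleftrightarrow> a < c" "\<pi> ! j < \<pi> ! k \<longleftrightarrow> b < c"
    by blast
  define f where "f = (\<lambda>u::nat. if u = 1 then Suc i else if u = 2 then Suc j else Suc k)"
  have 123: "{1..length [a, b, c]} = {1, 2, 3}"
    by auto
  have pairs: "(u = 1 \<and> v = 2) \<or> (u = 1 \<and> v = 3) \<or> (u = 2 \<and> v = 3)"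
    if "1 \<le> u" "u < v" "v \<le> length [a, b, c]" for u v :: nat
    using that by auto
  have "f ` {1..length [a, b, c]} \<subseteq> {1..length \<pi>}"
    unfolding 123 using * by (auto simp: f_def)
  moreover have "strict_mono_on {1..length [a, b, c]} f"
    unfolding 123 using * by (auto simp: f_def strict_mono_on_def)
  moreover have "ent \<pi> (f u) < ent \<pi> (f v) \<longleftrightarrow> ent [a, b, c] u < ent [a, b, c] v"
    if "1 \<le> u \<and> u < v \<and> v \<le> length [a, b, c]" for u v
    using pairs[of u v] that * by (auto simp: f_def ent_def)
  ultimately show ?L
    unfolding contains_pattern_def by blast
qed

lemma contains_123_iff:
  "contains_pattern \<pi> [1, 2, 3] \<longleftrightarrow>
    (\<exists>i j k. i < j \<and> j < k \<and> k < length \<pi> \<and> \<pi> ! i < \<pi> ! j \<and> \<pi> ! j < \<pi> ! k)"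
proof -
  have "u < v \<and> u < w \<and> v < w \<longleftrightarrow> u < v \<and> v < w" for u v w :: nat
    by auto
  then show ?thesis
    unfolding contains_pattern3 by simp
qed

lemma contains_312_iff:
  assumes "distinct \<pi>"
  shows "contains_pattern \<pi> [3, 1, 2] \<longleftrightarrow>
    (\<exists>i j k. i < j \<and> j < k \<and> k < length \<pi> \<and> \<pi> ! j < \<pi> ! k \<and> \<pi> ! k < \<pi> ! i)"
proof -
  have neq: "\<pi> ! i \<noteq> \<pi> ! k" if "i < j" "j < k" "k < length \<pi>" for i j k
    using that assms by (simp add: nth_eq_iff_index_eq)
  have "i < j \<and> j < k \<and> k < length \<pi> \<and>
        \<not> \<pi> ! i < \<pi> ! j \<and> \<not> \<pi> ! i < \<pi> ! k \<and> \<pi> ! j < \<pi> ! k \<longleftrightarrow>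
      i < j \<and> j < k \<and> k < length \<pi> \<and> \<pi> ! j < \<pi> ! k \<and> \<pi> ! k < \<pi> ! i"
    for i j k
    using neq[of i j k] by auto
  then show ?thesis
    unfolding contains_pattern3 by simp
qed

section \<open>The permutations avoiding both patterns\<close>

text \<open>
  In one-line notation this is \<open>y \<dots> x n \<dots> (y+1) (x-1) \<dots> 1\<close>, the interval \<open>{x..y}\<close> and then its
  complement in \<open>{1..n}\<close>, each in decreasing order.
\<close>

definition two_runs :: "nat \<Rightarrow> nat \<Rightarrow> nat \<Rightarrow> nat list" where
  "two_runs n x y = rev [x..<Suc y] @ rev ([1..<x] @ [Suc y..<Suc n])"

lemma decreasing_unique:
  assumes "sorted_wrt (>) xs" "sorted_wrt (>) ys" "set xs = set (ys :: nat list)"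
  shows "xs = ys"
  using assms strict_sorted_equal[of "rev xs" "rev ys"] by (simp add: sorted_wrt_rev)

text \<open>Of the three positions of a 123 two neighbouring ones would lie in the same run.\<close>

lemma two_decreasing_runs_no_123:
  assumes "sorted_wrt (>) xs" "sorted_wrt (>) (ys :: nat list)"
  shows "\<not> contains_pattern (xs @ ys) [1, 2, 3]"
proof
  assume "contains_pattern (xs @ ys) [1, 2, 3]"
  then obtain i j k where ijk: "i < j" "j < k" "k < length xs + length ys"
    and less: "(xs @ ys) ! i < (xs @ ys) ! j" "(xs @ ys) ! j < (xs @ ys) ! k"
    by (auto simp: contains_123_iff simp del: One_nat_def)
  show False
  proof (cases "j < length xs")
    case True
    then show False
      using less(1) ijk sorted_wrt_nth_less[OF assms(1), of i j] by (simp add: nth_append)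
  next
    case False
    then have "j - length xs < k - length xs" "k - length xs < length ys"
      using ijk by linarith+
    then show False
      using False less(2) ijk
        sorted_wrt_nth_less[OF assms(2), of "j - length xs" "k - length xs"]
      by (simp add: nth_append)
  qed
qed

text \<open>
  The ascent from the 1 to the 2 has to cross from the first run to the second. So the 3 and
  the 1 lie in the first run, and by convexity the value of the 2, which is between them, would have
  to lie there too.
\<close>

lemma convex_run_no_312:
  assumes "sorted_wrt (>) xs" "sorted_wrt (>) (ys :: nat list)" "distinct (xs @ ys)"
    and "set xs = {x..y}"
  shows "\<not> contains_pattern (xs @ ys) [3, 1, 2]"
proof
  assume "contains_pattern (xs @ ys) [3, 1, 2]"
  then obtain i j k where ijk: "i < j" "j < k" "k < length xs + length ys"
    and less: "(xs @ ys) ! j < (xs @ ys) ! k" "(xs @ ys) ! k < (xs @ ys) ! i"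
    using assms(3) by (auto simp: contains_312_iff simp del: One_nat_def)
  have j: "j < length xs"
  proof (rule ccontr)
    assume *: "\<not> j < length xs"
    then have "j - length xs < k - length xs" "k - length xs < length ys"
      using ijk by linarith+
    then show False
      using * less(1) ijk sorted_wrt_nth_less[OF assms(2), of "j - length xs" "k - length xs"]
      by (simp add: nth_append)
  qed
  have k: "\<not> k < length xs"
    using less(1) ijk sorted_wrt_nth_less[OF assms(1), of j k] by (auto simp: nth_append)
  have "xs ! i \<in> {x..y}" "xs ! j \<in> {x..y}"
    using j ijk nth_mem[of i xs] nth_mem[of j xs] by (simp_all flip: assms(4))
  then have "(xs @ ys) ! k \<in> set xs"
    using less j ijk assms(4) by (auto simp: nth_append)
  moreover have "(xs @ ys) ! k \<in> set ys"
    using k ijk by (auto simp: nth_append)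
  ultimately show False
    using assms(3) by auto
qed

text \<open>
  Let \<open>a b\<close> be the ascent. An increasing pair \<open>c < d\<close> in the prefix ending in \<open>a\<close> gives a 123 with
  \<open>b\<close> if \<open>d < b\<close>, and otherwise \<open>d a b\<close> is a 312. An increasing pair \<open>c < d\<close> in the suffix starting
  with \<open>b\<close> makes \<open>a b d\<close> a 123 if \<open>b < d\<close>, and otherwise \<open>b c d\<close> is a 312.
\<close>

lemma decreasing_if_avoids_after_ascent:
  assumes "\<not> contains_pattern \<pi> [1, 2, 3]" "\<not> contains_pattern \<pi> [3, 1, 2]"
    and "distinct \<pi>" "Suc i < length \<pi>" "\<pi> ! i < \<pi> ! Suc i"
  shows "sorted_wrt (>) (take (Suc i) \<pi>)" "sorted_wrt (>) (drop (Suc i) \<pi>)"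
proof -
  have no_123: "\<not> (\<pi> ! a < \<pi> ! b \<and> \<pi> ! b < \<pi> ! c)"
    and no_312: "\<not> (\<pi> ! b < \<pi> ! c \<and> \<pi> ! c < \<pi> ! a)"
    if "a < b" "b < c" "c < length \<pi>" for a b c
    using that assms(1,2) unfolding contains_123_iff contains_312_iff[OF assms(3)] by blast+
  have neq: "\<pi> ! a \<noteq> \<pi> ! b" if "a < b" "b < length \<pi>" for a b
    using that assms(3) by (simp add: nth_eq_iff_index_eq)
  have left: "\<pi> ! a > \<pi> ! b" if ab: "a < b" "b \<le> i" for a b
  proof (rule ccontr)
    assume "\<not> \<pi> ! a > \<pi> ! b"
    then have up: "\<pi> ! a < \<pi> ! b"
      using neq[of a b] ab assms(4) by simp
    have "\<not> \<pi> ! b < \<pi> ! Suc i"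
      using no_123[of a b "Suc i"] up ab assms(4) by auto
    then have "\<pi> ! Suc i < \<pi> ! b"
      using neq[of b "Suc i"] ab assms(4) by simp
    then have "b \<noteq> i"
      using assms(5) by auto
    then show False
      using no_312[of b i "Suc i"] \<open>\<pi> ! Suc i < \<pi> ! b\<close> assms(4,5) ab by simp
  qed
  have right: "\<pi> ! a > \<pi> ! b" if ab: "Suc i \<le> a" "a < b" "b < length \<pi>" for a b
  proof (rule ccontr)
    assume "\<not> \<pi> ! a > \<pi> ! b"
    then have up: "\<pi> ! a < \<pi> ! b"
      using neq[of a b] ab by simp
    have below: "\<pi> ! b < \<pi> ! Suc i"
      using no_123[of i "Suc i" b] neq[of "Suc i" b] ab assms(5)
      by (meson Suc_le_lessD le_less_trans lessI linorder_neqE_nat)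
    then have "a \<noteq> Suc i"
      using up by auto
    then show False
      using no_312[of "Suc i" a b] up below ab by simp
  qed
  show "sorted_wrt (>) (take (Suc i) \<pi>)"
    using left assms(4) by (auto simp: sorted_wrt_iff_nth_less)
  show "sorted_wrt (>) (drop (Suc i) \<pi>)"
    using right assms(4) by (auto simp: sorted_wrt_iff_nth_less)
qed

text \<open>
  Both runs around an ascent are determined by their value sets, since they decrease. The parameters
  \<open>x\<close> and \<open>y\<close> are the last and the first entry of the run that ends at the ascent.
\<close>

lemma avoider_with_ascent:
  assumes "\<not> contains_pattern \<pi> [1, 2, 3]" "\<not> contains_pattern \<pi> [3, 1, 2]"
    and "distinct \<pi>" "set \<pi> = {1..n}" "Suc i < length \<pi>" "\<pi> ! i < \<pi> ! Suc i"
  shows "\<exists>x y. 1 \<le> x \<and> x \<le> y \<and> y < n \<and> \<pi> = two_runs n x y"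
proof -
  define xs ys where "xs = take (Suc i) \<pi>" and "ys = drop (Suc i) \<pi>"
  define x y where "x = \<pi> ! i" and "y = \<pi> ! 0"
  have \<pi>: "\<pi> = xs @ ys"
    by (simp add: xs_def ys_def)
  have dec: "sorted_wrt (>) xs" "sorted_wrt (>) ys"
    using decreasing_if_avoids_after_ascent[OF assms(1-3,5,6)] by (simp_all add: xs_def ys_def)
  have no_312: "\<not> (\<pi> ! b < \<pi> ! c \<and> \<pi> ! c < \<pi> ! a)"
    if "a < b" "b < c" "c < length \<pi>" for a b c
    using that assms(2) unfolding contains_312_iff[OF assms(3)] by blast
  have nth: "\<pi> ! a > \<pi> ! b" if "a < b" "b \<le> i" for a b
    using sorted_wrt_nth_less[OF dec(1), of a b] that assms(5) by (simp add: xs_def)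
  have xy: "x \<le> y"
    using nth[of 0 i] by (cases "i = 0") (auto simp: x_def y_def)
  \<comment> \<open>A value strictly between \<open>x\<close> and \<open>y\<close> in the second run would be the 2 of a 312.\<close>
  have outside: "\<not> (x \<le> v \<and> v \<le> y)" if v: "v \<in> set ys" for v
  proof
    assume *: "x \<le> v \<and> v \<le> y"
    obtain k where k: "k < length ys" "v = ys ! k"
      using v by (auto simp: in_set_conv_nth)
    have vk: "v = \<pi> ! (Suc i + k)" "Suc i + k < length \<pi>"
      using k by (auto simp: ys_def)
    then have "v \<noteq> x" "v \<noteq> y"
      using nth_eq_iff_index_eq[OF assms(3), of "Suc i + k" 0]
        nth_eq_iff_index_eq[OF assms(3), of "Suc i + k" i] assms(5)
      unfolding x_def y_def by linarith+
    with * have "x < v" "v < y"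
      by auto
    then show False
      using no_312[of 0 i "Suc i + k"] vk by (cases "i = 0") (auto simp: x_def y_def)
  qed
  have sub: "set xs \<subseteq> {x..y}"
  proof
    fix v assume "v \<in> set xs"
    then obtain k where "k \<le> i" "v = \<pi> ! k"
      using assms(5) by (auto simp: xs_def in_set_conv_nth less_Suc_eq_le)
    then show "v \<in> {x..y}"
      using nth[of 0 k] nth[of k i]
      by (cases "k = 0"; cases "k = i") (auto simp: x_def y_def)
  qed
  have mem: "x \<in> {1..n}" "y \<in> {1..n}" "\<pi> ! Suc i \<in> {1..n}"
    using nth_mem[of 0 \<pi>] nth_mem[of i \<pi>] nth_mem[of "Suc i" \<pi>] assms(5)
    unfolding x_def y_def assms(4) by linarith+
  have sets: "set xs \<union> set ys = {1..n}"
    using assms(4) \<pi> by auto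
  have set_xs: "set xs = {x..y}"
  proof
    show "{x..y} \<subseteq> set xs"
    proof
      fix v assume v: "v \<in> {x..y}"
      then have "v \<in> set xs \<union> set ys"
        using mem by (auto simp: sets)
      then show "v \<in> set xs"
        using v outside[of v] by auto
    qed
  qed (fact sub)
  have "distinct (xs @ ys)"
    using assms(3) \<pi> by simp
  then have set_ys: "set ys = {1..n} - {x..y}"
    using sets set_xs by auto
  have "\<pi> ! Suc i \<in> set ys"
    using assms(5) by (auto simp: ys_def in_set_conv_nth intro!: exI[of _ 0])
  then have "y < n"
    using outside[of "\<pi> ! Suc i"] assms(6) mem by (auto simp: x_def)
  have "xs = rev [x..<Suc y]"
    by (rule decreasing_unique) (auto simp: dec set_xs sorted_wrt_rev simp del: upt_Suc)
  moreover have "ys = rev ([1..<x] @ [Suc y..<Suc n])"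
    using mem xy
    by (intro decreasing_unique)
      (auto simp: dec set_ys sorted_wrt_rev sorted_wrt_append simp del: upt_Suc)
  ultimately have "\<pi> = two_runs n x y"
    using \<pi> by (simp only: two_runs_def)
  then show ?thesis
    using xy mem \<open>y < n\<close> by auto
qed

lemma decreasing_or_ascent:
  assumes "distinct (\<pi> :: nat list)" "\<not> sorted_wrt (>) \<pi>"
  obtains i where "Suc i < length \<pi>" "\<pi> ! i < \<pi> ! Suc i"
proof -
  have "transp ((>) :: nat \<Rightarrow> nat \<Rightarrow> bool)"
    by (auto simp: transp_def)
  then obtain i where i: "Suc i < length \<pi>" "\<not> \<pi> ! i > \<pi> ! Suc i"
    using assms(2) by (auto simp: sorted_wrt_iff_nth_Suc_transp)
  moreover have "\<pi> ! i \<noteq> \<pi> ! Suc i"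
    using i assms(1) by (simp add: nth_eq_iff_index_eq)
  ultimately show ?thesis
    using that[of i] by auto
qed

lemma two_runs_decreasing:
  "sorted_wrt (>) (rev [x..<Suc y])"
  "x \<le> y \<Longrightarrow> sorted_wrt (>) (rev ([1..<x] @ [Suc y..<Suc n]))"
  by (auto simp: sorted_wrt_rev sorted_wrt_append simp del: upt_Suc)

lemma avoiders_123_312:
  "avoiders n {[1, 2, 3], [3, 1, 2]} =
    insert (rev [1..<Suc n]) ((\<lambda>(y, x). two_runs n x y) ` (SIGMA y:{1..<n}. {1..y}))"
  (is "?A = ?B")
proof (intro equalityI subsetI)
  fix \<pi> assume "\<pi> \<in> ?A"
  then have \<pi>: "set \<pi> = {1..n}" "distinct \<pi>"
    "\<not> contains_pattern \<pi> [1, 2, 3]" "\<not> contains_pattern \<pi> [3, 1, 2]"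
    by (auto simp: avoiders_def permutations_of_set_def)
  show "\<pi> \<in> ?B"
  proof (cases "sorted_wrt (>) \<pi>")
    case True
    moreover have "set \<pi> = set (rev [1..<Suc n])"
      unfolding \<pi>(1) by (auto simp del: upt_Suc)
    ultimately have "\<pi> = rev [1..<Suc n]"
      by (intro decreasing_unique two_runs_decreasing(1))
    then show ?thesis
      by (simp only: insertI1)
  next
    case False
    then obtain i where "Suc i < length \<pi>" "\<pi> ! i < \<pi> ! Suc i"
      using \<pi>(2) by (elim decreasing_or_ascent)
    then obtain x y where "1 \<le> x" "x \<le> y" "y < n" "\<pi> = two_runs n x y"
      using avoider_with_ascent[OF \<pi>(3,4,2,1)] by blast
    then show ?thesis
      by (intro insertI2 image_eqI[of _ _ "(y, x)"]) auto
  qed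
next
  fix \<pi> assume "\<pi> \<in> ?B"
  then consider "\<pi> = rev [1..<Suc n]"
    | x y where "1 \<le> x" "x \<le> y" "y < n" "\<pi> = two_runs n x y"
    by auto
  then show "\<pi> \<in> ?A"
  proof cases
    case 1
    have dec: "sorted_wrt (>) \<pi>"
      unfolding 1 by (rule two_runs_decreasing)
    have \<pi>: "set \<pi> = {1..n}" "distinct \<pi>"
      unfolding 1 by (auto simp del: upt_Suc)
    \<comment> \<open>The decreasing permutation is treated as a first run with empty second run.\<close>
    show ?thesis
      using \<pi> two_decreasing_runs_no_123[OF dec, of "[]"]
        convex_run_no_312[OF dec, of "[]" 1 n]
      by (simp add: avoiders_def permutations_of_set_def)
  next
    case 2
    let ?xs = "rev [x..<Suc y]" and ?ys = "rev ([1..<x] @ [Suc y..<Suc n])"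
    have \<pi>: "set (?xs @ ?ys) = {1..n}" "distinct (?xs @ ?ys)" "set ?xs = {x..y}"
      using 2 by (auto simp del: upt_Suc)
    show ?thesis
      unfolding 2(4) two_runs_def
      using \<pi> two_decreasing_runs_no_123[OF two_runs_decreasing(1) two_runs_decreasing(2)[OF 2(2)],
          of x y n]
        convex_run_no_312[OF two_runs_decreasing(1) two_runs_decreasing(2)[OF 2(2)],
          of x y n x y]
      by (simp add: avoiders_def permutations_of_set_def del: upt_Suc)
  qed
qed

section \<open>The statistics on these permutations\<close>

lemma DES_decreasing:
  assumes "sorted_wrt (>) xs"
  shows "DES xs = {1..<length xs}"
  using sorted_wrt_nth_less[OF assms] by (auto simp: DES_def ent_def)

lemma DES_two_decreasing_runs:
  assumes "sorted_wrt (>) xs" "sorted_wrt (>) ys" "xs \<noteq> []" "ys \<noteq> []" "last xs < hd ys"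
  shows "DES (xs @ ys) = {1..<length xs + length ys} - {length xs}"
proof -
  have "ent (xs @ ys) i > ent (xs @ ys) (i + 1) \<longleftrightarrow> i \<noteq> length xs"
    if i: "1 \<le> i" "i < length xs + length ys" for i
  proof (rule linorder_cases[of i "length xs"])
    assume "i < length xs"
    then show ?thesis
      using i sorted_wrt_nth_less[OF assms(1), of "i - 1" i]
      by (simp add: ent_def nth_append less_imp_diff_less)
  next
    assume "i = length xs"
    then show ?thesis
      using assms(3-5) by (simp add: ent_def nth_append last_conv_nth hd_conv_nth)
  next
    assume "i > length xs"
    then have "i - 1 - length xs < i - length xs" "\<not> i - 1 < length xs"
      using i by linarith+
    then show ?thesis
      using \<open>i > length xs\<close> i
        sorted_wrt_nth_less[OF assms(2), of "i - 1 - length xs" "i - length xs"]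
      by (simp add: ent_def nth_append)
  qed
  then show ?thesis
    by (auto simp: DES_def)
qed

lemma length_two_runs: "1 \<le> x \<Longrightarrow> x \<le> y \<Longrightarrow> y < n \<Longrightarrow> length (two_runs n x y) = n"
  by (simp add: two_runs_def del: upt_Suc)

lemma DES_two_runs:
  assumes "1 \<le> x" "x \<le> y" "y < n"
  shows "DES (two_runs n x y) = {1..<n} - {Suc y - x}"
proof -
  have "last (rev [x..<Suc y]) < hd (rev ([1..<x] @ [Suc y..<Suc n]))"
    using assms by (simp add: last_rev hd_rev upt_conv_Cons)
  moreover have "rev [x..<Suc y] \<noteq> []" "rev ([1..<x] @ [Suc y..<Suc n]) \<noteq> []"
    using assms by auto
  ultimately have "DES (two_runs n x y) =
      {1..<length (two_runs n x y)} - {length (rev [x..<Suc y])}"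
    unfolding two_runs_def length_append
    using assms by (intro DES_two_decreasing_runs two_runs_decreasing) auto
  then show ?thesis
    using length_two_runs[OF assms] by (simp del: upt_Suc)
qed

lemma des_two_runs:
  assumes "1 \<le> x" "x \<le> y" "y < n"
  shows "des (two_runs n x y) = n - 2"
  unfolding des_def DES_two_runs[OF assms] using assms by (subst card_Diff_singleton) auto

lemma iar_two_runs:
  assumes "1 \<le> x" "x \<le> y" "y < n"
  shows "iar (two_runs n x y) = (if x = y then 2 else 1)"
  unfolding iar_def DES_two_runs[OF assms] length_two_runs[OF assms]
  using assms by (intro Min_eqI) (auto simp: Suc_le_eq)

text \<open>
  The entries that matter for the components: all of the first run, and the \<open>n\<close> that follows it.
\<close>

lemma ent_two_runs:
  assumes "1 \<le> x" "x \<le> y" "y < n"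
  shows "1 \<le> j \<Longrightarrow> j \<le> Suc y - x \<Longrightarrow> ent (two_runs n x y) j = Suc y - j"
    and "ent (two_runs n x y) (Suc (Suc y - x)) = n"
  using assms
  by (auto simp: two_runs_def ent_def nth_append rev_nth simp del: upt_Suc)

text \<open>
  A prefix of length \<open>i < n\<close> with all entries at most \<open>i\<close> cannot contain \<open>n\<close>, so it is part of the
  first run and \<open>i \<le> y - x + 1\<close>; it contains \<open>y\<close>, so \<open>y \<le> i\<close>. Both together force \<open>x = 1\<close> and
  \<open>i = y\<close>.
\<close>

lemma perm_comp_two_runs:
  assumes "1 \<le> x" "x \<le> y" "y < n"
  shows "perm_comp (two_runs n x y) = (if x = 1 then 2 else 1)"
proof -
  let ?w = "two_runs n x y"
  have le_n: "ent ?w j \<le> n" if "j \<in> {1..n}" for j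
  proof -
    have "ent ?w j \<in> set ?w"
      using that length_two_runs[OF assms] by (auto simp: ent_def)
    then show ?thesis
      using assms by (auto simp: two_runs_def simp del: upt_Suc)
  qed
  have "(\<forall>j\<in>{1..i}. ent ?w j \<le> i) \<longleftrightarrow> i = n \<or> (x = 1 \<and> i = y)" if i: "i \<in> {1..n}" for i
  proof
    assume all: "\<forall>j\<in>{1..i}. ent ?w j \<le> i"
    have "y \<le> i"
      using bspec[OF all, of 1] ent_two_runs(1)[OF assms, of 1] i assms by simp
    moreover have "i \<le> Suc y - x" if "i \<noteq> n"
      using bspec[OF all, of "Suc (Suc y - x)"] ent_two_runs(2)[OF assms] i that
      by (cases "i \<le> Suc y - x") auto
    ultimately show "i = n \<or> (x = 1 \<and> i = y)"
      using assms by linarith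
  next
    assume "i = n \<or> (x = 1 \<and> i = y)"
    then show "\<forall>j\<in>{1..i}. ent ?w j \<le> i"
      using le_n ent_two_runs(1)[OF assms] by auto
  qed
  then have "{i \<in> {1..n}. \<forall>j\<in>{1..i}. ent ?w j \<le> i} = {i \<in> {1..n}. i = n \<or> (x = 1 \<and> i = y)}"
    by blast
  also have "\<dots> = (if x = 1 then {y, n} else {n})"
    using assms by auto
  finally show ?thesis
    using assms by (simp add: perm_comp_def length_two_runs[OF assms])
qed

lemma decreasing_statistics:
  assumes "1 \<le> n"
  shows "des (rev [1..<Suc n]) = n - 1" "iar (rev [1..<Suc n]) = 1"
    "perm_comp (rev [1..<Suc n]) = 1"
proof -
  let ?w = "rev [1..<Suc n]"
  have len: "length ?w = n"
    by simp
  have DES: "DES ?w = {1..<n}"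
    using DES_decreasing[OF two_runs_decreasing(1)] len by metis
  show "des ?w = n - 1"
    unfolding des_def DES by simp
  show "iar ?w = 1"
    unfolding iar_def DES len using assms by (intro Min_eqI) auto
  have ent: "ent ?w j = Suc n - j" if "j \<in> {1..n}" for j
    using that by (auto simp: ent_def rev_nth simp del: upt_Suc)
  have "(\<forall>j\<in>{1..i}. ent ?w j \<le> i) \<longleftrightarrow> i = n" if i: "i \<in> {1..n}" for i
  proof
    assume "\<forall>j\<in>{1..i}. ent ?w j \<le> i"
    then have "ent ?w 1 \<le> i"
      using i by auto
    then show "i = n"
      using ent[of 1] i assms by simp
  next
    assume "i = n"
    then show "\<forall>j\<in>{1..i}. ent ?w j \<le> i"
      using ent by (auto simp del: upt_Suc)
  qed
  then have "{i \<in> {1..n}. \<forall>j\<in>{1..i}. ent ?w j \<le> i} = {i \<in> {1..n}. i = n}"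
    by blast
  also have "\<dots> = {n}"
    using assms by auto
  finally show "perm_comp ?w = 1"
    unfolding perm_comp_def len by simp
qed

text \<open>The first entry recovers \<open>y\<close>, and then the position of the ascent recovers \<open>x\<close>.\<close>

lemma inj_on_two_runs:
  "inj_on (\<lambda>(y, x). two_runs n x y) (SIGMA y:{1..<n}. {1..y})"
proof (rule inj_onI, clarify)
  fix x y x' y' assume *: "y \<in> {1..<n}" "x \<in> {1..y}" "y' \<in> {1..<n}" "x' \<in> {1..y'}"
    and eq: "two_runs n x y = two_runs n x' y'"
  have "ent (two_runs n x y) 1 = y" "ent (two_runs n x' y') 1 = y'"
    using * ent_two_runs(1)[of x y n 1] ent_two_runs(1)[of x' y' n 1] by auto
  then have "y = y'"
    using eq by simp
  have "{1..<n} - {Suc y - x} = {1..<n} - {Suc y' - x'}"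
    using * eq DES_two_runs[of x y n] DES_two_runs[of x' y' n] by simp
  moreover have "Suc y - x \<in> {1..<n}" "Suc y' - x' \<in> {1..<n}"
    using * by auto
  ultimately have "Suc y - x = Suc y' - x'"
    by blast
  with \<open>y = y'\<close> * show "y = y' \<and> x = x'"
    by auto
qed

lemma decreasing_not_two_runs:
  "rev [1..<Suc n] \<notin> (\<lambda>(y, x). two_runs n x y) ` (SIGMA y:{1..<n}. {1..y})"
proof
  assume "rev [1..<Suc n] \<in> (\<lambda>(y, x). two_runs n x y) ` (SIGMA y:{1..<n}. {1..y})"
  then obtain x y where *: "1 \<le> x" "x \<le> y" "y < n" "rev [1..<Suc n] = two_runs n x y"
    by auto
  then have "des (rev [1..<Suc n]) = n - 2"
    using des_two_runs by metis
  then show False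
    using decreasing_statistics(1)[of n] * by linarith
qed

section \<open>The generating function\<close>

text \<open>
  Induction adds the column \<open>y = m + 2\<close> of the triangle: its two ends \<open>x = 1\<close> and \<open>x = y\<close> lie on
  the sides of the triangle, and its \<open>m\<close> inner points have weight \<open>r p\<close>.
\<close>

lemma sum_over_pairs:
  fixes r p :: "'a :: comm_ring_1"
  shows "(\<Sum>y=1..Suc m. \<Sum>x=1..y. r ^ (if x = y then 2 else 1) * p ^ (if x = 1 then 2 else 1)) =
    r * p * (r * p + of_nat m * (r + p) + of_nat (m choose 2))"
proof (induction m)
  case 0
  show ?case
    by (simp add: power2_eq_square binomial_eq_0 algebra_simps)
next
  case (Suc m)
  let ?f = "\<lambda>y x. r ^ (if x = y then 2 else 1) * p ^ (if x = (1::nat) then 2 else 1)"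
  have "{1..Suc (Suc m)} = insert 1 (insert (Suc (Suc m)) {2..Suc m})"
    by auto
  then have "(\<Sum>x=1..Suc (Suc m). ?f (Suc (Suc m)) x) =
      ?f (Suc (Suc m)) 1 + (\<Sum>x=2..Suc m. ?f (Suc (Suc m)) x) + ?f (Suc (Suc m)) (Suc (Suc m))"
    by simp
  also have "(\<Sum>x=2..Suc m. ?f (Suc (Suc m)) x) = (\<Sum>x=2..Suc m. r * p)"
    by (rule sum.cong) auto
  finally have column: "(\<Sum>x=1..Suc (Suc m). ?f (Suc (Suc m)) x) = r * p * (r + p + of_nat m)"
    by (simp add: power2_eq_square algebra_simps)
  have "(\<Sum>y=1..Suc (Suc m). \<Sum>x=1..y. ?f y x) =
      (\<Sum>y=1..Suc m. \<Sum>x=1..y. ?f y x) + (\<Sum>x=1..Suc (Suc m). ?f (Suc (Suc m)) x)"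
    by simp
  also have "\<dots> = r * p * (r * p + of_nat m * (r + p) + of_nat (m choose 2))
      + r * p * (r + p + of_nat m)"
    unfolding column Suc.IH ..
  also have "\<dots> = r * p * (r * p + of_nat (Suc m) * (r + p) + of_nat (Suc m choose 2))"
    by (simp add: algebra_simps numeral_2_eq_2)
  finally show ?case .
qed

lemma perm_gf_nth_Suc:
  fixes t r p :: "'a :: field"
  shows "fps_nth (perm_gf {[1, 2, 3], [3, 1, 2]} t r p) (Suc m) = r * p *
    (t ^ m + (if m = 0 then 0 else
      t ^ (m - 1) * (r * p + of_nat (m - 1) * (r + p) + of_nat ((m - 1) choose 2))))"
proof -
  let ?n = "Suc m"
  let ?S = "SIGMA y:{1..<?n}. {1..y}"
  let ?wt = "\<lambda>\<pi>. t ^ des \<pi> * r ^ iar \<pi> * p ^ perm_comp \<pi>"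
  have "fps_nth (perm_gf {[1, 2, 3], [3, 1, 2]} t r p) ?n =
      ?wt (rev [1..<Suc ?n]) + (\<Sum>\<pi>\<in>(\<lambda>(y, x). two_runs ?n x y) ` ?S. ?wt \<pi>)"
    unfolding perm_gf_def fps_nth_Abs_fps avoiders_123_312
    by (rule sum.insert[OF _ decreasing_not_two_runs]) auto
  also have "?wt (rev [1..<Suc ?n]) = r * p * t ^ m"
    using decreasing_statistics[of ?n] by (simp del: upt_Suc)
  also have "(\<Sum>\<pi>\<in>(\<lambda>(y, x). two_runs ?n x y) ` ?S. ?wt \<pi>) =
      (\<Sum>(y, x)\<in>?S. ?wt (two_runs ?n x y))"
    by (subst sum.reindex[OF inj_on_two_runs]) (simp add: case_prod_unfold)
  also have "\<dots> = (\<Sum>y=1..<?n. \<Sum>x=1..y. ?wt (two_runs ?n x y))"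
    by (rule sum.Sigma[symmetric]) auto
  also have "\<dots> = (\<Sum>y=1..m. \<Sum>x=1..y. t ^ (m - 1) *
      (r ^ (if x = y then 2 else 1) * p ^ (if x = 1 then 2 else 1)))"
    by (intro sum.cong)
      (auto simp: des_two_runs iar_two_runs perm_comp_two_runs)
  also have "\<dots> = t ^ (m - 1) * (\<Sum>y=1..m. \<Sum>x=1..y.
      r ^ (if x = y then 2 else 1) * p ^ (if x = 1 then 2 else 1))"
    by (simp only: sum_distrib_left)
  also have "\<dots> = (if m = 0 then 0 else t ^ (m - 1) *
      (r * p * (r * p + of_nat (m - 1) * (r + p) + of_nat ((m - 1) choose 2))))"
    using sum_over_pairs[of r p "m - 1"] by (cases m) simp_all
  finally show ?thesis
    by (simp add: algebra_simps)
qed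

text \<open>
  Multiplication by \<open>1 - t z\<close> takes each of the three series to the preceding one, the first
  one to 1; on coefficients this is Pascal's rule.
\<close>

lemma fps_powers_of_geometric:
  fixes t :: "'a :: field"
  defines "d \<equiv> 1 - fps_const t * fps_X"
  shows "f / d = f * Abs_fps (\<lambda>n. t ^ n)"
    and "f / d ^ 2 = f * Abs_fps (\<lambda>n. of_nat (Suc n) * t ^ n)"
    and "f / d ^ 3 = f * Abs_fps (\<lambda>n. of_nat (Suc (Suc n) choose 2) * t ^ n)"
proof -
  let ?G = "Abs_fps (\<lambda>n. t ^ n)"
  let ?G2 = "Abs_fps (\<lambda>n. of_nat (Suc n) * t ^ n)"
  let ?G3 = "Abs_fps (\<lambda>n. of_nat (Suc (Suc n) choose 2) * t ^ n)"
  have nth: "fps_nth (d * Abs_fps g) n = g n - (if n = 0 then 0 else t * g (n - 1))" for g n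
  proof -
    have "d * Abs_fps g = Abs_fps g - fps_const t * (fps_X * Abs_fps g)"
      by (simp only: d_def left_diff_distrib mult_1_left mult.assoc)
    then show ?thesis
      by simp
  qed
  have 1: "d * ?G = 1"
    by (rule fps_ext, subst nth) (auto simp: power_eq_if)
  have 2: "d * ?G2 = ?G"
    by (rule fps_ext, subst nth) (auto simp: gr0_conv_Suc algebra_simps)
  have 3: "d * ?G3 = ?G2"
    by (rule fps_ext, subst nth)
      (auto simp: gr0_conv_Suc algebra_simps numeral_2_eq_2)
  have unit: "f / e = f * g" if "e * g = 1" for e g :: "'a fps"
  proof -
    have "e \<noteq> 0"
      using that by auto
    have "f = (f * g) * e"
      using that by (simp add: mult.assoc mult.commute[of g])
    then show ?thesis
      using \<open>e \<noteq> 0\<close> by (metis nonzero_mult_div_cancel_right)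
  qed
  show "f / d = f * ?G"
    by (rule unit) (fact 1)
  show "f / d ^ 2 = f * ?G2"
    by (rule unit) (simp only: power2_eq_square mult.assoc 1 2)
  show "f / d ^ 3 = f * ?G3"
    by (rule unit) (simp only: power3_eq_cube mult.assoc 1 2 3)
qed

theorem theorem4p4:
  fixes t r p :: "'a :: field"
  assumes "r \<noteq> 0" and "p \<noteq> 0"
  shows "perm_gf_tilde {[1,2,3], [3,1,2]} t r p =
    (1 + fps_const r * fps_const p * fps_X) / (1 - fps_const t * fps_X)
    + (fps_const r + fps_const p) * fps_const t * fps_X ^ 2 / (1 - fps_const t * fps_X) ^ 2
    + fps_const t ^ 2 * fps_X ^ 3 / (1 - fps_const t * fps_X) ^ 3"
proof (rule fps_ext)
  fix m
  let ?P = "{[1, 2, 3], [3, 1, 2 :: nat]}"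
  let ?c = "t ^ m + (if m = 0 then 0 else
      t ^ (m - 1) * (r * p + of_nat (m - 1) * (r + p) + of_nat ((m - 1) choose 2)))"
  have "r * p * fps_nth (perm_gf_tilde ?P t r p) m =
      fps_nth (fps_const r * fps_const p * fps_X * perm_gf_tilde ?P t r p) (Suc m)"
    by (simp add: mult.assoc)
  also have "\<dots> = fps_nth (perm_gf ?P t r p - 1) (Suc m)"
    using assms by (subst perm_gf_tilde_exact) auto
  also have "\<dots> = r * p * ?c"
    using perm_gf_nth_Suc[of t r p m] by simp
  finally have lhs: "fps_nth (perm_gf_tilde ?P t r p) m = ?c"
    using assms by simp
  let ?R = "(1 + fps_const r * fps_const p * fps_X) / (1 - fps_const t * fps_X)
    + (fps_const r + fps_const p) * fps_const t * fps_X ^ 2 / (1 - fps_const t * fps_X) ^ 2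
    + fps_const t ^ 2 * fps_X ^ 3 / (1 - fps_const t * fps_X) ^ 3"
  let ?G = "Abs_fps (\<lambda>n. t ^ n)"
  have rhs_series: "?R = ?G + fps_const (r * p) * (fps_X * ?G)
      + fps_const ((r + p) * t) * (fps_X ^ 2 * Abs_fps (\<lambda>n. of_nat (Suc n) * t ^ n))
      + fps_const (t ^ 2) * (fps_X ^ 3 * Abs_fps (\<lambda>n. of_nat (Suc (Suc n) choose 2) * t ^ n))"
    unfolding fps_powers_of_geometric
    by (simp only: distrib_right mult.assoc mult_1_left
        fps_const_mult[symmetric] fps_const_add[symmetric] fps_const_power[symmetric])
  let ?e = "t ^ m + (if m = 0 then 0 else r * p * t ^ (m - 1))
      + (if m < 2 then 0 else (r + p) * t * (of_nat (Suc (m - 2)) * t ^ (m - 2)))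
      + (if m < 3 then 0 else t ^ 2 * (of_nat (Suc (Suc (m - 3)) choose 2) * t ^ (m - 3)))"
  have rhs: "fps_nth ?R m = ?e"
    unfolding rhs_series
    by (simp only: fps_add_nth fps_mult_left_const_nth fps_X_mult_nth fps_X_power_mult_nth
        fps_nth_Abs_fps if_distrib[of "(*) _"] mult_zero_right)
  \<comment> \<open>The shifts by 1, 2 and 3 make the small exponents special.\<close>
  consider "m = 0" | "m = 1" | "m = 2" | k where "m = Suc (Suc (Suc k))"
    by (metis One_nat_def Suc_1 not0_implies_Suc)
  then have "?c = ?e"
  proof cases
    case 4
    show ?thesis
      unfolding 4 by (simp add: algebra_simps power2_eq_square del: binomial_Suc_Suc)
  qed (simp_all add: binomial_eq_0 algebra_simps)
  then show "fps_nth (perm_gf_tilde ?P t r p) m = fps_nth ?R m"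
    by (simp only: lhs rhs)
qed

end
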